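(* There are Martin-Löf tests $\mathcal U=(\mathcal U_i)_{i\in\omega}$ and $\mathcal V=(\mathcal V_i)_{i\in\omega}$ such that $\mathcal U$ is universal but there exists $i\in\omega$ such that for all $j\in\omega$, $\mathcal V_j\not\subseteq\mathcal U_i$.
   Context: Work in Cantor space $2^\omega$ with Lebesgue measure $\lambda$. For $\sigma\in 2^{<\omega}$, $[\sigma]=\{X\in 2^\omega:\sigma\prec X\}$. A sequence $(\mathcal U_i)_{i\in\omega}$ of open subsets of $2^\omega$ is uniformly effectively open if $\{\langle i,\sigma\rangle : [\sigma]\subseteq\mathcal U_i\}$ is computably enumerable. A Martin-Löf (ML) test is a uniformly effectively open sequence $(\mathcal V_i)_{i\in\omega}$ with $\lambda(\mathcal V_i)\le 2^{-i}$ for all $i$. An ML-test $\mathcal U$ is universal if $\bigcap_i\mathcal V_i\subseteq\bigcap_i\mathcal U_i$ for every ML-test $\mathcal V$. *)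

theory Defs
  imports "HOL-Probability.Probability" "HOL-Library.Nat_Bijection"
begin

datatype recf = Z | S | Id nat | Cn recf "recf list" | Pr recf recf | Mn recf

inductive reval :: "recf \<Rightarrow> nat list \<Rightarrow> nat \<Rightarrow> bool" where
  reval_Z: "reval Z xs 0"
| reval_S: "reval S (x # xs) (Suc x)"
| reval_Id: "i < length xs \<Longrightarrow> reval (Id i) xs (xs ! i)"
| reval_Cn: "length ys = length gs \<Longrightarrow> (\<forall>k < length gs. reval (gs ! k) xs (ys ! k))
             \<Longrightarrow> reval f ys z \<Longrightarrow> reval (Cn f gs) xs z"
| reval_Pr0: "reval f xs y \<Longrightarrow> reval (Pr f g) (0 # xs) y"
| reval_PrS: "reval (Pr f g) (n # xs) y \<Longrightarrow> reval g (y # n # xs) z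
             \<Longrightarrow> reval (Pr f g) (Suc n # xs) z"
| reval_Mn: "reval f (n # xs) 0 \<Longrightarrow> (\<forall>m < n. \<exists>y. reval f (m # xs) y \<and> y \<noteq> 0)
             \<Longrightarrow> reval (Mn f) xs n"

definition ce :: "nat set \<Rightarrow> bool" where
  "ce A \<longleftrightarrow> (\<exists>f. A = {x. \<exists>y. reval f [x] y})"

definition cyl :: "bool list \<Rightarrow> (nat \<Rightarrow> bool) set" where
  "cyl \<sigma> = {X. \<forall>n < length \<sigma>. X n = \<sigma> ! n}"

definition cantor_open :: "(nat \<Rightarrow> bool) set \<Rightarrow> bool" where
  "cantor_open U \<longleftrightarrow> (\<forall>X \<in> U. \<exists>\<sigma>. X \<in> cyl \<sigma> \<and> cyl \<sigma> \<subseteq> U)"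

text \<open>Computable bijective coding of strings: the binary expansion with a leading 1.\<close>
fun str_code :: "bool list \<Rightarrow> nat" where
  "str_code [] = 1"
| "str_code (b # \<sigma>) = 2 * str_code \<sigma> + (if b then 1 else 0)"

definition pair_code :: "nat \<Rightarrow> bool list \<Rightarrow> nat" where
  "pair_code i \<sigma> = prod_encode (i, str_code \<sigma>)"

definition lebesgue_cantor :: "(nat \<Rightarrow> bool) measure" where
  "lebesgue_cantor = (\<Pi>\<^sub>M n\<in>(UNIV::nat set). measure_pmf (pmf_of_set (UNIV :: bool set)))"

definition unif_eff_open :: "(nat \<Rightarrow> (nat \<Rightarrow> bool) set) \<Rightarrow> bool" where
  "unif_eff_open U \<longleftrightarrow> (\<forall>i. cantor_open (U i))
     \<and> ce {pair_code i \<sigma> | i \<sigma>. cyl \<sigma> \<subseteq> U i}"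

definition MartinLoef_test :: "(nat \<Rightarrow> (nat \<Rightarrow> bool) set) \<Rightarrow> bool" where
  "MartinLoef_test V \<longleftrightarrow> unif_eff_open V
     \<and> (\<forall>i. emeasure lebesgue_cantor (V i) \<le> ennreal ((1/2) ^ i))"

definition universal_MartinLoef_test :: "(nat \<Rightarrow> (nat \<Rightarrow> bool) set) \<Rightarrow> bool" where
  "universal_MartinLoef_test U \<longleftrightarrow> MartinLoef_test U \<and> (\<forall>V. MartinLoef_test V \<longrightarrow> (\<Inter>i. V i) \<subseteq> (\<Inter>i. U i))"

end

theory Submission
  imports Defs
begin

text \<open>
  A universal test W is obtained from an enumeration of all c.e. sets by cutting each sequence off when
  its measure gets too large. Since the first component W_1 has measure at most 1/2, for every t there is a
  string of length t that is not accepted by W_1 at stage t; let tau_t be the least such string and put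
  V_t = [tau_t]. The test U only keeps those points of W_{i+1} which, for every t smaller than the length at
  which they are accepted, lie in W_{t+1} whenever they extend tau_t. This removes no point of the
  intersection of W, so U is universal, but U_0 meets [tau_t] only inside W_{t+1}, whose measure is
  smaller than that of [tau_t].
\<close>

text \<open>The standard universal test W cannot serve as U itself: a Martin-Loef test V with index
  c is never cut off, so W_i contains the whole component V_{i+c+1}. Thinning has to destroy this
  inclusion while leaving the intersection alone. Choosing strings outside U_0 directly would be
  circular, since U is built from them; they are therefore chosen against W_1, which is fixed
  beforehand. It suffices that tau_t is not accepted by stage t: this is decidable, so tau_t is
  computable from t, whereas [tau_t] may well meet W_1 later and even be covered by it. That late
  part is what the thinning cuts down to W_{t+1}. A point accepted into W_1 at length s extends no
  tau_t with t >= s, so only the finitely many conditions with t < s have to be imposed, and the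
  thinned sets stay effectively open. Index 1 is the first whose measure bound 2^(-i) is below 1,
  hence the shift from U_i to W_{i+1}.\<close>

section \<open>Computable functions of an environment\<close>

text \<open>Demanding a program for every sufficiently large arity makes padding with unused arguments
  free, so closure rules need no arity bookkeeping.\<close>

definition computable :: "((nat \<Rightarrow> nat) \<Rightarrow> nat) \<Rightarrow> bool" where
  "computable f \<longleftrightarrow> (\<exists>N. \<forall>n\<ge>N. \<exists>r. \<forall>e. reval r (map e [0..<n]) (f e))"

definition decidable :: "((nat \<Rightarrow> nat) \<Rightarrow> bool) \<Rightarrow> bool" where
  "decidable P \<longleftrightarrow> computable (\<lambda>e. of_bool (P e))"

named_theorems comp_intros

lemma computable_var [comp_intros]: "computable (\<lambda>e. e i)"
  unfolding computable_def
proof (intro exI allI impI)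
  fix n e assume "Suc i \<le> n"
  then show "reval (Id i) (map e [0..<n]) (e i)"
    using reval_Id[of i "map e [0..<n]"] by simp
qed

text \<open>Some program for \<open>h\<close> reads only the first \<open>M\<close> arguments, so a
  common arity is needed for just the finitely many \<open>a i\<close> with
  \<open>i < M\<close>.\<close>

lemma computable_subst:
  assumes h: "computable h" and a: "\<And>i. computable (a i)"
  shows "computable (\<lambda>e. h (\<lambda>i. a i e))"
proof -
  obtain M r where r: "\<And>e. reval r (map e [0..<M]) (h e)"
    using h unfolding computable_def by (metis order_refl)
  obtain N where N: "\<And>i n. n \<ge> N i \<Longrightarrow> \<exists>r. \<forall>e. reval r (map e [0..<n]) (a i e)"
    using a unfolding computable_def by metis
  show ?thesis
    unfolding computable_def
  proof (intro exI[of _ "Max (N ` {..<M})"] allI impI)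
    fix n assume n: "Max (N ` {..<M}) \<le> n"
    have "\<exists>r. \<forall>e. reval r (map e [0..<n]) (a i e)" if "i < M" for i
    proof (rule N)
      have "N i \<le> Max (N ` {..<M})" using that by (intro Max_ge) auto
      with n show "N i \<le> n" by linarith
    qed
    then obtain q where q: "\<And>i e. i < M \<Longrightarrow> reval (q i) (map e [0..<n]) (a i e)"
      by metis
    have "reval (Cn r (map q [0..<M])) (map e [0..<n]) (h (\<lambda>i. a i e))" for e
      by (rule reval_Cn[where ys = "map (\<lambda>i. a i e) [0..<M]"]) (auto intro: q r)
    then show "\<exists>r. \<forall>e. reval r (map e [0..<n]) (h (\<lambda>i. a i e))" by blast
  qed
qed

lemma computable_Suc [comp_intros]:
  assumes "computable f"
  shows "computable (\<lambda>e. Suc (f e))"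
proof -
  have "computable (\<lambda>e. Suc (e 0))"
    unfolding computable_def
  proof (intro exI allI impI)
    fix n e assume "Suc 0 \<le> n"
    then show "reval S (map e [0..<n]) (Suc (e 0))"
      using reval_S[of "e 0" "map e [Suc 0..<n]"] by (simp add: upt_rec)
  qed
  from computable_subst[OF this, of "\<lambda>_. f"] assms show ?thesis by simp
qed

lemma computable_const [comp_intros]: "computable (\<lambda>e. c)"
proof (induction c)
  case 0
  show ?case unfolding computable_def using reval_Z by blast
next
  case (Suc c)
  then show ?case by (rule computable_Suc)
qed

lemma map_case_nat_upt: "map (case_nat k e) [0..<Suc n] = k # map e [0..<n]"
  by (simp add: map_upt_Suc del: upt_Suc)

text \<open>The slots in the hypothesis on \<open>g\<close> follow the argument order of
  \<open>Pr\<close>: previous value, counter, then the parameters. The recursion is first built with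
  its bound in slot 0, and \<open>b\<close> is substituted afterwards.\<close>

lemma computable_rec [comp_intros]:
  assumes a: "computable a"
    and g: "computable (\<lambda>e. g (e 0) (e (Suc 0)) (\<lambda>i. e (Suc (Suc i))))"
    and b: "computable b"
  shows "computable (\<lambda>e. rec_nat (a e) (\<lambda>k y. g y k e) (b e))"
proof -
  have "computable (\<lambda>e. rec_nat (a (\<lambda>i. e (Suc i))) (\<lambda>k y. g y k (\<lambda>i. e (Suc i))) (e 0))"
  proof -
    obtain Na where Na: "\<And>n. n \<ge> Na \<Longrightarrow> \<exists>r. \<forall>e. reval r (map e [0..<n]) (a e)"
      using a unfolding computable_def by metis
    obtain Ng where Ng: "\<And>n. n \<ge> Ng \<Longrightarrow>
        \<exists>r. \<forall>e. reval r (map e [0..<n]) (g (e 0) (e (Suc 0)) (\<lambda>i. e (Suc (Suc i))))"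
      using g unfolding computable_def by metis
    show ?thesis
      unfolding computable_def
    proof (intro exI[of _ "Suc (max Na Ng)"] allI impI)
      fix n assume "Suc (max Na Ng) \<le> n"
      then obtain m where m: "n = Suc m" "m \<ge> Na" "m \<ge> Ng" by (cases n) auto
      obtain ra where ra: "\<And>e. reval ra (map e [0..<m]) (a e)"
        using Na m by metis
      obtain rg where
        "\<And>e. reval rg (map e [0..<Suc (Suc m)]) (g (e 0) (e (Suc 0)) (\<lambda>i. e (Suc (Suc i))))"
        using Ng[of "Suc (Suc m)"] m by auto
      from this[of "case_nat _ (case_nat _ _)"]
      have rg: "reval rg (y # k # map e [0..<m]) (g y k e)" for y k e
        unfolding map_case_nat_upt by simp
      have "reval (Pr ra rg) (k # map e [0..<m]) (rec_nat (a e) (\<lambda>k y. g y k e) k)" for e k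
        by (induction k) (auto intro: reval_Pr0 reval_PrS ra rg)
      from this[of "e 0" "\<lambda>i. e (Suc i)" for e]
      show "\<exists>r. \<forall>e. reval r (map e [0..<n])
              (rec_nat (a (\<lambda>i. e (Suc i))) (\<lambda>k y. g y k (\<lambda>i. e (Suc i))) (e 0))"
        unfolding m by (auto simp: map_upt_Suc simp del: upt_Suc)
    qed
  qed
  \<comment> \<open>The substitution that puts \<open>b\<close> into slot 0 and undoes the shift of
    all other slots.\<close>
  moreover have "computable (case i of 0 \<Rightarrow> b | Suc i \<Rightarrow> \<lambda>e. e i)" for i
    using b by (cases i) (simp_all add: computable_var)
  ultimately show ?thesis
    using computable_subst[of _ "case_nat b (\<lambda>i e. e i)"] by force
qed

text \<open>Totality of \<open>g\<close> supplies the defined, nonzero values that the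
  \<open>Mn\<close> rule demands below the least zero. As in the later rules for sums and bounded
  quantifiers, the bound variable sits in slot 0 and the rest of the environment is shifted by
  one.\<close>

lemma computable_Least_zero:
  assumes g: "computable (\<lambda>e. g (e 0) (\<lambda>i. e (Suc i)))"
    and ex: "\<And>e. \<exists>k. g k e = 0"
  shows "computable (\<lambda>e. LEAST k. g k e = 0)"
proof -
  obtain N where N: "\<And>n. n \<ge> N \<Longrightarrow> \<exists>r. \<forall>e. reval r (map e [0..<n]) (g (e 0) (\<lambda>i. e (Suc i)))"
    using g unfolding computable_def by metis
  show ?thesis
    unfolding computable_def
  proof (intro exI[of _ N] allI impI)
    fix n assume "N \<le> n"
    then obtain r where "\<And>e. reval r (map e [0..<Suc n]) (g (e 0) (\<lambda>i. e (Suc i)))"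
      using N[of "Suc n"] by auto
    from this[of "case_nat _ _"]
    have r: "reval r (k # map e [0..<n]) (g k e)" for k e
      unfolding map_case_nat_upt by simp
    have "reval (Mn r) (map e [0..<n]) (LEAST k. g k e = 0)" for e
    proof (rule reval_Mn)
      have "g (LEAST k. g k e = 0) e = 0"
        using ex[of e] by (metis (mono_tags, lifting) LeastI)
      with r[of "LEAST k. g k e = 0" e]
      show "reval r ((LEAST k. g k e = 0) # map e [0..<n]) 0" by simp
      show "\<forall>m<(LEAST k. g k e = 0). \<exists>y. reval r (m # map e [0..<n]) y \<and> y \<noteq> 0"
        using r not_less_Least by blast
    qed
    then show "\<exists>r. \<forall>e. reval r (map e [0..<n]) (LEAST k. g k e = 0)" by blast
  qed
qed

section \<open>Closure under arithmetic, Boolean operations, bounded quantifiers and search\<close>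

lemma computable_add [comp_intros]:
  assumes "computable a" "computable b" shows "computable (\<lambda>e. a e + b e)"
proof -
  have "rec_nat x (\<lambda>k y. Suc y) y = x + y" for x y :: nat by (induction y) auto
  moreover have "computable (\<lambda>e. rec_nat (a e) (\<lambda>k y. Suc y) (b e))"
    by (intro comp_intros assms)
  ultimately show ?thesis by simp
qed

lemma computable_mult [comp_intros]:
  assumes "computable a" "computable b" shows "computable (\<lambda>e. a e * b e)"
proof -
  have "rec_nat 0 (\<lambda>k z. z + x) y = x * y" for x y :: nat by (induction y) auto
  moreover have "computable (\<lambda>e. rec_nat 0 (\<lambda>k y. y + a e) (b e))"
    by (intro comp_intros assms computable_subst[OF assms(1)])
  ultimately show ?thesis by simp
qed

lemma computable_power [comp_intros]:
  assumes "computable a" "computable b" shows "computable (\<lambda>e. a e ^ b e)"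
proof -
  have "rec_nat 1 (\<lambda>k z. z * x) y = x ^ y" for x y :: nat by (induction y) auto
  moreover have "computable (\<lambda>e. rec_nat 1 (\<lambda>k y. y * a e) (b e))"
    by (intro comp_intros assms computable_subst[OF assms(1)])
  ultimately show ?thesis by simp
qed

lemma computable_diff [comp_intros]:
  assumes "computable a" "computable b" shows "computable (\<lambda>e. a e - b e)"
proof -
  have pred: "computable (\<lambda>e. c e - 1)" if "computable c" for c
  proof -
    have "rec_nat 0 (\<lambda>k z. k) y = y - 1" for y :: nat by (induction y) auto
    moreover have "computable (\<lambda>e. rec_nat 0 (\<lambda>k y. k) (c e))"
      by (intro comp_intros that)
    ultimately show ?thesis by simp
  qed
  have "rec_nat x (\<lambda>k z. z - 1) y = x - y" for x y :: nat by (induction y) auto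
  moreover have "computable (\<lambda>e. rec_nat (a e) (\<lambda>k y. y - 1) (b e))"
    by (intro computable_rec pred comp_intros assms)
  ultimately show ?thesis by simp
qed

lemma computable_sum [comp_intros]:
  assumes "computable (\<lambda>e. g (e 0) (\<lambda>i. e (Suc i)))" "computable b"
  shows "computable (\<lambda>e. \<Sum>k<b e. g k e)"
proof -
  have "rec_nat 0 (\<lambda>k y. y + g k e) n = (\<Sum>k<n. g k e)" for n e by (induction n) auto
  moreover have "computable (\<lambda>e. rec_nat 0 (\<lambda>k y. y + g k e) (b e))"
    using computable_subst[OF assms(1), of "\<lambda>i e. e (Suc i)", OF computable_var]
    by (intro comp_intros assms(2)) simp
  ultimately show ?thesis by simp
qed

lemma computable_of_bool [comp_intros]: "decidable P \<Longrightarrow> computable (\<lambda>e. of_bool (P e))"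
  by (simp add: decidable_def)

lemma decidable_eq_zero:
  assumes "computable a" shows "decidable (\<lambda>e. a e = 0)"
proof -
  have "computable (\<lambda>e. 1 - a e)" by (intro comp_intros assms)
  moreover have "1 - x = of_bool (x = 0)" for x :: nat by auto
  ultimately show ?thesis by (simp add: decidable_def)
qed

lemma decidable_le [comp_intros]:
  assumes "computable a" "computable b" shows "decidable (\<lambda>e. a e \<le> b e)"
  using decidable_eq_zero[OF computable_diff[OF assms]] by simp

lemma decidable_less [comp_intros]:
  assumes "computable a" "computable b" shows "decidable (\<lambda>e. a e < b e)"
  using decidable_le[OF computable_Suc[OF assms(1)] assms(2)] by (simp add: Suc_le_eq)

lemma decidable_not [comp_intros]:
  assumes "decidable P" shows "decidable (\<lambda>e. \<not> P e)"
  using decidable_eq_zero[OF computable_of_bool[OF assms]] by simp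

lemma decidable_conj [comp_intros]:
  assumes "decidable P" "decidable Q" shows "decidable (\<lambda>e. P e \<and> Q e)"
  using computable_mult[OF assms[unfolded decidable_def]] by (simp add: decidable_def of_bool_conj)

lemma decidable_disj [comp_intros]:
  assumes "decidable P" "decidable Q" shows "decidable (\<lambda>e. P e \<or> Q e)"
  using decidable_not[OF decidable_conj[OF assms[THEN decidable_not]]] by simp

lemma decidable_imp [comp_intros]:
  assumes "decidable P" "decidable Q" shows "decidable (\<lambda>e. P e \<longrightarrow> Q e)"
  unfolding imp_conv_disj by (intro comp_intros assms)

lemma decidable_iff [comp_intros]:
  assumes "decidable P" "decidable Q" shows "decidable (\<lambda>e. P e \<longleftrightarrow> Q e)"
  unfolding iff_conv_conj_imp by (intro comp_intros assms)

lemma decidable_eq [comp_intros]: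
  assumes "computable a" "computable b" shows "decidable (\<lambda>e. a e = b e)"
  unfolding eq_iff by (intro comp_intros assms)

lemma decidable_Bex_less [comp_intros]:
  assumes "decidable (\<lambda>e. P (e 0) (\<lambda>i. e (Suc i)))" "computable b"
  shows "decidable (\<lambda>e. \<exists>k<b e. P k e)"
proof -
  have "(\<exists>k<b e. P k e) \<longleftrightarrow> \<not> (\<Sum>k<b e. of_bool (P k e)) = (0::nat)" for e by auto
  moreover have "decidable (\<lambda>e. \<not> (\<Sum>k<b e. of_bool (P k e)) = (0::nat))"
    by (intro comp_intros assms)
  ultimately show ?thesis by simp
qed

lemma decidable_Bex_lessThan [comp_intros]:
  assumes "decidable (\<lambda>e. P (e 0) (\<lambda>i. e (Suc i)))" "computable b"
  shows "decidable (\<lambda>e. \<exists>k\<in>{..<b e}. P k e)"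
  using decidable_Bex_less[OF assms] by (simp add: Bex_def)

lemma decidable_Ball_less [comp_intros]:
  assumes "decidable (\<lambda>e. P (e 0) (\<lambda>i. e (Suc i)))" "computable b"
  shows "decidable (\<lambda>e. \<forall>k<b e. P k e)"
  using decidable_not[OF decidable_Bex_less[OF decidable_not[OF assms(1)] assms(2)]] by simp

lemma decidable_Bex_le [comp_intros]:
  assumes "decidable (\<lambda>e. P (e 0) (\<lambda>i. e (Suc i)))" "computable b"
  shows "decidable (\<lambda>e. \<exists>k\<le>b e. P k e)"
  using decidable_Bex_less[OF assms(1) computable_Suc[OF assms(2)]] by (simp add: less_Suc_eq_le)

lemma decidable_Ball_le [comp_intros]:
  assumes "decidable (\<lambda>e. P (e 0) (\<lambda>i. e (Suc i)))" "computable b"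
  shows "decidable (\<lambda>e. \<forall>k\<le>b e. P k e)"
  using decidable_Ball_less[OF assms(1) computable_Suc[OF assms(2)]] by (simp add: less_Suc_eq_le)

lemma computable_Least:
  assumes "decidable (\<lambda>e. P (e 0) (\<lambda>i. e (Suc i)))" "\<And>e. \<exists>k. P k e"
  shows "computable (\<lambda>e. LEAST k. P k e)"
proof -
  have "computable (\<lambda>e. LEAST k. (of_bool (\<not> P k e) :: nat) = 0)"
    by (rule computable_Least_zero) (use assms in \<open>auto intro!: comp_intros\<close>)
  then show ?thesis by simp
qed

text \<open>With this and the next two rules a named function or predicate is treated once with
  plain variables as arguments; otherwise every binder in its body would force a shift of the
  environment inside the arguments.\<close>

lemma computable_comp1:
  assumes "computable (\<lambda>e. g (e 0))" "computable a"
  shows "computable (\<lambda>e. g (a e))"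
  using computable_subst[OF assms(1), of "\<lambda>_. a"] assms(2) by simp

lemma decidable_comp2:
  assumes "decidable (\<lambda>e. P (e 0) (e (Suc 0)))" "computable a" "computable b"
  shows "decidable (\<lambda>e. P (a e) (b e))"
  using computable_subst[OF assms(1)[unfolded decidable_def], of "\<lambda>i. if i = 0 then a else b"] assms(2,3)
  by (simp add: decidable_def)

lemma decidable_comp3:
  assumes "decidable (\<lambda>e. P (e 0) (e (Suc 0)) (e (Suc (Suc 0))))"
    and "computable a" "computable b" "computable c"
  shows "decidable (\<lambda>e. P (a e) (b e) (c e))"
  using computable_subst[OF assms(1)[unfolded decidable_def],
      of "\<lambda>i. if i = 0 then a else if i = 1 then b else c"] assms(2-)
  by (simp add: decidable_def)

section \<open>Determinism of evaluation; c.e. sets as projections\<close>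

inductive_cases reval_ZE: "reval Z xs y"
inductive_cases reval_SE: "reval S xs y"
inductive_cases reval_IdE: "reval (Id i) xs y"
inductive_cases reval_CnE: "reval (Cn f gs) xs y"
inductive_cases reval_Pr0E: "reval (Pr f g) (0 # xs) y"
inductive_cases reval_PrSE: "reval (Pr f g) (Suc n # xs) y"
inductive_cases reval_MnE: "reval (Mn f) xs y"

lemma reval_det:
  assumes "reval r xs y" "reval r xs z"
  shows "y = z"
  using assms
proof (induction arbitrary: z rule: reval.induct)
  case (reval_Cn ys gs xs f y)
  from reval_Cn.prems obtain ys' where ys': "length ys' = length gs"
    "\<forall>k<length gs. reval (gs ! k) xs (ys' ! k)" "reval f ys' z"
    by (auto elim!: reval_CnE)
  with reval_Cn have "ys = ys'" by (intro nth_equalityI) auto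
  with reval_Cn ys' show ?case by blast
next
  case (reval_PrS f g n xs y w)
  from reval_PrS.prems obtain y' where "reval (Pr f g) (n # xs) y'" "reval g (y' # n # xs) z"
    by (auto elim!: reval_PrSE)
  with reval_PrS show ?case by blast
next
  case (reval_Mn f n xs)
  from reval_Mn.prems have z: "reval f (z # xs) 0" "\<forall>m<z. \<exists>y. reval f (m # xs) y \<and> y \<noteq> 0"
    by (auto elim!: reval_MnE)
  \<comment> \<open>If two minima differed, the larger one would require a nonzero value at the
    smaller one, where \<open>f\<close> also takes the value 0; the induction hypothesis excludes
    this.\<close>
  with reval_Mn show ?case by (metis linorder_neqE_nat)
qed (blast elim: reval_ZE reval_SE reval_IdE reval_Pr0E)+

text \<open>Unbounded search for a witness halts exactly on the members. Conversely, determinism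
  turns the value 0 found by the search into a true instance of \<open>P\<close>.\<close>

lemma ce_projection:
  assumes "decidable (\<lambda>e. P (e 0) (e (Suc 0)))"
  shows "ce {x. \<exists>s. P x s}"
proof -
  have "computable (\<lambda>e. of_bool (\<not> P (e (Suc 0)) (e 0)))"
    by (intro comp_intros decidable_comp2[OF assms])
  then obtain n r where r0: "\<And>e. reval r (map e [0..<n]) (of_bool (\<not> P (e (Suc 0)) (e 0)))"
    unfolding computable_def by (metis order_refl)
  \<comment> \<open>The program \<open>r\<close> expects \<open>n\<close> arguments but receives the
    list \<open>[s, x]\<close>; the missing ones are filled with 0.\<close>
  define gs where "gs = map (\<lambda>i. if i < 2 then Id i else Z) [0..<n]"
  have r: "reval (Cn r gs) [s, x] (of_bool (\<not> P x s))" for s x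
  proof (rule reval_Cn)
    let ?e = "\<lambda>i. if i = 0 then s else if i = 1 then x else 0"
    show "reval r (map ?e [0..<n]) (of_bool (\<not> P x s))" using r0[of ?e] by simp
    show "\<forall>k<length gs. reval (gs ! k) [s, x] (map ?e [0..<n] ! k)"
      using reval_Id[of 0 "[s, x]"] reval_Id[of 1 "[s, x]"]
      by (auto simp: gs_def less_2_cases_iff intro: reval_Z)
  qed (simp add: gs_def)
  have "(\<exists>s. P x s) \<longleftrightarrow> (\<exists>y. reval (Mn (Cn r gs)) [x] y)" for x
  proof
    assume "\<exists>s. P x s"
    then have least: "P x (LEAST s. P x s)" by (metis LeastI)
    have "reval (Mn (Cn r gs)) [x] (LEAST s. P x s)"
    proof (intro reval_Mn allI impI)
      show "reval (Cn r gs) [LEAST s. P x s, x] 0"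
        using r[of "LEAST s. P x s" x] least by simp
      show "\<exists>y. reval (Cn r gs) [m, x] y \<and> y \<noteq> 0" if "m < (LEAST s. P x s)" for m
        using r[of m x] not_less_Least[OF that] by (intro exI[of _ 1]) simp
    qed
    then show "\<exists>y. reval (Mn (Cn r gs)) [x] y" by blast
  next
    assume "\<exists>y. reval (Mn (Cn r gs)) [x] y"
    then obtain y where "reval (Cn r gs) [y, x] 0" by (auto elim: reval_MnE)
    from reval_det[OF this r] show "\<exists>s. P x s" by auto
  qed
  then show ?thesis unfolding ce_def by blast
qed

section \<open>A decidable step relation for partial recursive functions\<close>

definition pfst :: "nat \<Rightarrow> nat" where "pfst z = fst (prod_decode z)"
definition psnd :: "nat \<Rightarrow> nat" where "psnd z = snd (prod_decode z)"

lemma pfst_encode [simp]: "pfst (prod_encode (a, b)) = a"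
  and psnd_encode [simp]: "psnd (prod_encode (a, b)) = b"
  by (simp_all add: pfst_def psnd_def)

lemma prod_encode_pfst_psnd [simp]: "prod_encode (pfst z, psnd z) = z"
  by (simp add: pfst_def psnd_def)

lemma computable_prod_encode [comp_intros]:
  assumes "computable a" "computable b"
  shows "computable (\<lambda>e. prod_encode (a e, b e))"
proof -
  have "triangle n = (\<Sum>k<n. Suc k)" for n by (induction n) auto
  then have "prod_encode (m, n) = (\<Sum>k<m + n. Suc k) + m" for m n by (simp add: prod_encode_def)
  moreover have "computable (\<lambda>e. (\<Sum>k<a e + b e. Suc k) + a e)"
    by (intro comp_intros assms)
  ultimately show ?thesis by simp
qed

lemma computable_pfst [comp_intros]:
  assumes "computable a"
  shows "computable (\<lambda>e. pfst (a e))"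
proof -
  have "\<exists>b\<le>z. prod_encode (pfst z, b) = z" for z
    using le_prod_encode_2[of "psnd z" "pfst z"] by (intro exI[of _ "psnd z"]) simp
  then have "(LEAST x. \<exists>b\<le>z. prod_encode (x, b) = z) = pfst z" for z
    by (intro Least_equality) auto
  moreover have "computable (\<lambda>e. LEAST x. \<exists>b\<le>e 0. prod_encode (x, b) = e 0)"
    by (rule computable_Least, intro comp_intros) (use \<open>\<And>z. \<exists>b\<le>z. _ z b\<close> in blast)
  ultimately show ?thesis
    using computable_comp1[of pfst, OF _ assms] by simp
qed

lemma computable_psnd [comp_intros]:
  assumes "computable a"
  shows "computable (\<lambda>e. psnd (a e))"
proof -
  have "(LEAST x. prod_encode (pfst z, x) = z) = psnd z" for z
    by (intro Least_equality) (auto dest: arg_cong[of _ _ psnd])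
  moreover have "computable (\<lambda>e. LEAST x. prod_encode (pfst (e 0), x) = e 0)"
    by (rule computable_Least, intro comp_intros) (use prod_encode_pfst_psnd in blast)
  ultimately show ?thesis
    using computable_comp1[of psnd, OF _ assms] by simp
qed

section \<open>Operations on numerical codes of lists\<close>

definition cons_code :: "nat \<Rightarrow> nat \<Rightarrow> nat" where "cons_code x c = Suc (prod_encode (x, c))"
definition hd_code :: "nat \<Rightarrow> nat" where "hd_code c = pfst (c - 1)"
definition tl_code :: "nat \<Rightarrow> nat" where "tl_code c = psnd (c - 1)"
text \<open>Dropping past the end yields 0, the code of the empty list. Thus
  \<open>drop_code k c = 0\<close> says that the list has at most \<open>k\<close> entries, and
  lengths are compared in this form.\<close>

definition drop_code :: "nat \<Rightarrow> nat \<Rightarrow> nat" where "drop_code i c = rec_nat c (\<lambda>_. tl_code) i"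
definition nth_code :: "nat \<Rightarrow> nat \<Rightarrow> nat" where "nth_code c i = hd_code (drop_code i c)"

lemma computable_cons_code [comp_intros]:
  assumes "computable a" "computable b" shows "computable (\<lambda>e. cons_code (a e) (b e))"
  unfolding cons_code_def by (intro comp_intros assms)

lemma computable_hd_code [comp_intros]:
  assumes "computable a" shows "computable (\<lambda>e. hd_code (a e))"
  unfolding hd_code_def by (intro comp_intros assms)

lemma computable_tl_code [comp_intros]:
  assumes "computable a" shows "computable (\<lambda>e. tl_code (a e))"
  unfolding tl_code_def by (intro comp_intros assms)

lemma computable_drop_code [comp_intros]:
  assumes "computable a" "computable b" shows "computable (\<lambda>e. drop_code (a e) (b e))"
  unfolding drop_code_def by (intro comp_intros assms)

lemma computable_nth_code [comp_intros]:
  assumes "computable a" "computable b" shows "computable (\<lambda>e. nth_code (a e) (b e))"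
  unfolding nth_code_def by (intro comp_intros assms)

declare list_encode.simps(2) [simp del]

lemma cons_code_list_encode [simp]: "cons_code x (list_encode xs) = list_encode (x # xs)"
  by (simp add: cons_code_def list_encode.simps(2))

lemma list_encode_eq_0_iff [simp]: "list_encode xs = 0 \<longleftrightarrow> xs = []"
  by (cases xs) (auto simp: list_encode.simps(2))

lemma hd_code_Cons [simp]: "hd_code (list_encode (x # xs)) = x"
  by (simp add: hd_code_def list_encode.simps(2))

lemma tl_code_list_encode [simp]: "tl_code (list_encode xs) = list_encode (tl xs)"
  \<comment> \<open>This instance amounts to \<open>psnd 0 = 0\<close>, which makes the tail of the
    empty list empty.\<close>
  using psnd_encode[of 0 0, unfolded prod_encode_def]
  by (cases xs) (simp_all add: tl_code_def list_encode.simps(2))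

lemma drop_code_list_encode [simp]: "drop_code i (list_encode xs) = list_encode (drop i xs)"
  unfolding drop_code_def
  by (induction i) (simp_all add: drop_Suc tl_drop)

lemma nth_code_list_encode [simp]: "i < length xs \<Longrightarrow> nth_code (list_encode xs) i = xs ! i"
  by (simp add: nth_code_def Cons_nth_drop_Suc[symmetric])

text \<open>Allows the code of a list to bound a quantifier over its positions.\<close>

lemma length_le_list_encode: "length xs \<le> list_encode xs"
proof (induction xs)
  case (Cons x xs)
  then show ?case using le_prod_encode_2[of "list_encode xs" x] by (simp add: list_encode.simps(2))
qed simp

section \<open>Program codes and one-step justification of evaluation claims\<close>

fun recf_code :: "recf \<Rightarrow> nat" where
  "recf_code Z = prod_encode (0, 0)"
| "recf_code S = prod_encode (1, 0)"
| "recf_code (Id i) = prod_encode (2, i)"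
| "recf_code (Cn f gs) = prod_encode (3, prod_encode (recf_code f, list_encode (map recf_code gs)))"
| "recf_code (Pr f g) = prod_encode (4, prod_encode (recf_code f, recf_code g))"
| "recf_code (Mn f) = prod_encode (5, recf_code f)"

definition claim_code :: "nat \<Rightarrow> nat \<Rightarrow> nat \<Rightarrow> nat" where
  "claim_code c xs y = prod_encode (c, prod_encode (xs, y))"

abbreviation prog :: "nat \<Rightarrow> nat" where "prog w \<equiv> pfst w"
abbreviation args :: "nat \<Rightarrow> nat" where "args w \<equiv> pfst (psnd w)"
abbreviation res :: "nat \<Rightarrow> nat" where "res w \<equiv> psnd (psnd w)"

lemma claim_code_sel [simp]: "prog (claim_code c xs y) = c" "args (claim_code c xs y) = xs" "res (claim_code c xs y) = y"
  by (simp_all add: claim_code_def)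

lemma computable_claim_code [comp_intros]:
  assumes "computable a" "computable b" "computable c"
  shows "computable (\<lambda>e. claim_code (a e) (b e) (c e))"
  unfolding claim_code_def by (intro comp_intros assms)

text \<open>A number codes the claim that the program \<^term>\<open>c\<close> maps the list \<^term>\<open>xs\<close> to \<^term>\<open>y\<close>;
  it is justified by the claims in \<^term>\<open>D\<close> if it follows from them by one rule of \<^const>\<open>reval\<close>.\<close>

definition justified_claim :: "nat set \<Rightarrow> nat \<Rightarrow> nat \<Rightarrow> nat \<Rightarrow> bool" where
  "justified_claim D c xs y \<longleftrightarrow>
     (pfst c = 0 \<and> y = 0)
   \<or> (pfst c = 1 \<and> xs \<noteq> 0 \<and> y = Suc (hd_code xs))
   \<or> (pfst c = 2 \<and> drop_code (psnd c) xs \<noteq> 0 \<and> y = nth_code xs (psnd c))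
   \<or> (pfst c = 3 \<and> (\<exists>w\<in>D. prog w = pfst (psnd c) \<and> res w = y
        \<and> (\<forall>k\<le>args w + psnd (psnd c). drop_code k (args w) = 0 \<longleftrightarrow> drop_code k (psnd (psnd c)) = 0)
        \<and> (\<forall>k<psnd (psnd c). drop_code k (psnd (psnd c)) \<noteq> 0 \<longrightarrow>
              claim_code (nth_code (psnd (psnd c)) k) xs (nth_code (args w) k) \<in> D)))
   \<or> (pfst c = 4 \<and> xs \<noteq> 0 \<and> hd_code xs = 0 \<and> claim_code (pfst (psnd c)) (tl_code xs) y \<in> D)
   \<or> (pfst c = 4 \<and> xs \<noteq> 0 \<and> hd_code xs \<noteq> 0
        \<and> (\<exists>w\<in>D. prog w = c \<and> args w = cons_code (hd_code xs - 1) (tl_code xs)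
              \<and> claim_code (psnd (psnd c)) (cons_code (res w) (args w)) y \<in> D))
   \<or> (pfst c = 5 \<and> claim_code (psnd c) (cons_code y xs) 0 \<in> D
        \<and> (\<forall>m<y. \<exists>w\<in>D. prog w = psnd c \<and> args w = cons_code m xs \<and> res w \<noteq> 0))"

definition justified :: "nat set \<Rightarrow> nat \<Rightarrow> bool" where
  "justified D z \<longleftrightarrow> justified_claim D (prog z) (args z) (res z)"

lemma Bex_image: "(\<exists>y\<in>f ` A. P y) \<longleftrightarrow> (\<exists>x\<in>A. P (f x))"
  by blast

text \<open>The set of available claims is given as the first \<open>K\<close> entries of a coded
  list, so membership in it and quantification over it become bounded quantifiers over
  positions.\<close>

lemma decidable_justified [comp_intros]:
  assumes "computable s" "computable K" "computable z"
  shows "decidable (\<lambda>e. justified (nth_code (s e) ` {..<K e}) (z e))"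
  apply (rule decidable_comp3[where P = "\<lambda>s K z. justified (nth_code s ` {..<K}) z"])
     apply (simp only: justified_def justified_claim_def Bex_image image_iff)
     apply (intro comp_intros)
    apply (rule assms)+
  done

lemma justified_mono: "justified D z \<Longrightarrow> D \<subseteq> D' \<Longrightarrow> justified D' z"
  unfolding justified_def justified_claim_def by (elim disj_forward) blast+

text \<open>A claim whose first component codes no program counts as true, so soundness can be
  proved for derivations that contain meaningless numbers.\<close>

definition true_claim :: "nat \<Rightarrow> bool" where
  "true_claim w \<longleftrightarrow> (\<forall>f. recf_code f = prog w \<longrightarrow> reval f (list_decode (args w)) (res w))"

lemma true_claim_code_iff:
  "true_claim (claim_code c xs y) \<longleftrightarrow> (\<forall>f. recf_code f = c \<longrightarrow> reval f (list_decode xs) y)"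
  by (simp add: true_claim_def claim_code_def)

lemma justified_sound:
  assumes "justified D z" and D: "\<And>w. w \<in> D \<Longrightarrow> true_claim w"
  shows "true_claim z"
proof -
  define xs where "xs = list_decode (args z)"
  have xs: "args z = list_encode xs" by (simp add: xs_def)
  have "reval f xs (res z)" if f: "recf_code f = prog z" for f
  proof (cases f)
    case (Cn h gs)
    from assms(1) obtain w where w: "w \<in> D" "prog w = recf_code h" "res w = res z"
      and len: "\<And>k. k \<le> args w + list_encode (map recf_code gs) \<Longrightarrow>
        drop_code k (args w) = 0 \<longleftrightarrow> drop_code k (list_encode (map recf_code gs)) = 0"
      and k: "\<And>k. k < list_encode (map recf_code gs) \<Longrightarrow> k < length gs \<Longrightarrow>
         claim_code (nth_code (list_encode (map recf_code gs)) k) (list_encode xs) (nth_code (args w) k) \<in> D"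
      unfolding justified_def justified_claim_def f[symmetric] Cn xs by auto
    define ys where "ys = list_decode (args w)"
    have ys: "args w = list_encode ys" by (simp add: ys_def)
    \<comment> \<open>Both lengths lie within the bound of the quantifier, and
      \<open>drop_code\<close> vanishes exactly from the length onwards; comparing at each of the
      two lengths gives both inequalities.\<close>
    have "length ys = length gs"
      using len[of "length ys"] len[of "length gs"] length_le_list_encode[of ys]
        length_le_list_encode[of "map recf_code gs"]
      unfolding ys by auto
    moreover have "reval (gs ! i) xs (ys ! i)" if "i < length gs" for i
      using D[OF k[of i]] that length_le_list_encode[of "map recf_code gs"] \<open>length ys = length gs\<close>
      unfolding ys by (auto simp: true_claim_code_iff)
    moreover have "reval h ys (res z)"
      using D[OF w(1)] w(2,3) by (auto simp: true_claim_def ys_def)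
    ultimately show ?thesis unfolding Cn by (intro reval_Cn[of ys]) auto
  next
    case (Pr g h)
    note j = assms(1)[unfolded justified_def justified_claim_def f[symmetric] Pr xs]
    then obtain x xs' where l: "xs = x # xs'" by (cases xs) auto
    show ?thesis
    proof (cases x)
      case 0
      with j l have "claim_code (recf_code g) (list_encode xs') (res z) \<in> D"
        by (auto)
      from D[OF this] show ?thesis unfolding Pr l 0 by (auto intro!: reval_Pr0 simp: true_claim_code_iff)
    next
      case (Suc n)
      with j l obtain w where w: "w \<in> D" "prog w = recf_code (Pr g h)"
        "args w = list_encode (n # xs')"
        "claim_code (recf_code h) (list_encode (res w # n # xs')) (res z) \<in> D"
        by (auto)
      with D[OF w(1)] D[OF w(4)]
      show ?thesis unfolding Pr l Suc
        by (auto intro!: reval_PrS simp: true_claim_code_iff true_claim_def simp del: recf_code.simps)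
    qed
  next
    case (Mn g)
    from assms(1) have 0: "claim_code (recf_code g) (list_encode (res z # xs)) 0 \<in> D"
      and m: "\<And>m. m < res z \<Longrightarrow>
         \<exists>w\<in>D. prog w = recf_code g \<and> args w = list_encode (m # xs) \<and> res w \<noteq> 0"
      unfolding justified_def justified_claim_def f[symmetric] Mn xs
      by (auto)
    show ?thesis unfolding Mn
    proof (intro reval_Mn allI impI)
      show "reval g (res z # xs) 0"
        using D[OF 0] by (auto simp: true_claim_code_iff)
      show "\<exists>y. reval g (m # xs) y \<and> y \<noteq> 0" if "m < res z" for m
      proof -
        from m[OF that] obtain w where "w \<in> D" "prog w = recf_code g"
          "args w = list_encode (m # xs)" "res w \<noteq> 0" by blast
        with D[of w] show ?thesis by (auto simp: true_claim_def)
      qed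
    qed
  next
    case S
    with assms(1) show ?thesis
      unfolding justified_def justified_claim_def f[symmetric] S xs
      by (cases xs) (auto intro: reval_S)
  next
    case (Id i)
    with assms(1) show ?thesis
      unfolding justified_def justified_claim_def f[symmetric] Id xs
      by (auto intro: reval_Id)
  next
    case Z
    with assms(1) show ?thesis
      unfolding justified_def justified_claim_def f[symmetric] Z xs
      by (auto intro: reval_Z)
  qed
  then show ?thesis by (simp add: true_claim_def xs_def)
qed

section \<open>Derivations as finite, checkable certificates of evaluations\<close>

definition derivation :: "nat list \<Rightarrow> bool" where
  "derivation L \<longleftrightarrow> (\<forall>k<length L. justified (set (take k L)) (L ! k))"

lemma derivation_append:
  assumes "derivation L" "derivation L'"
  shows "derivation (L @ L')"
  using assms unfolding derivation_def
  by (auto simp: nth_append intro!: justified_mono[OF _ Un_upper2])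

lemma derivation_snoc:
  assumes "derivation L" "justified (set L) z"
  shows "derivation (L @ [z])"
  using assms unfolding derivation_def by (simp add: nth_append less_Suc_eq)

definition derivable :: "nat \<Rightarrow> bool" where
  "derivable z \<longleftrightarrow> (\<exists>L. derivation L \<and> z \<in> set L)"

lemma derivable_finite_set:
  assumes "finite A" "\<And>z. z \<in> A \<Longrightarrow> derivable z"
  shows "\<exists>L. derivation L \<and> A \<subseteq> set L"
  using assms
proof (induction A)
  case empty
  show ?case by (intro exI[of _ "[]"]) (simp add: derivation_def)
next
  case (insert z A)
  then obtain L L' where "derivation L" "A \<subseteq> set L" "derivation L'" "z \<in> set L'"
    unfolding derivable_def by blast
  then show ?case by (intro exI[of _ "L @ L'"]) (auto intro: derivation_append)
qed

lemma derivable_justified: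
  assumes "finite A" "\<And>z. z \<in> A \<Longrightarrow> derivable z" "justified A z"
  shows "derivable z"
proof -
  from derivable_finite_set[OF assms(1,2)] obtain L where "derivation L" "A \<subseteq> set L" by blast
  with assms(3) have "derivation (L @ [z])" by (blast intro: derivation_snoc justified_mono)
  then show ?thesis unfolding derivable_def by force
qed

abbreviation claim :: "recf \<Rightarrow> nat list \<Rightarrow> nat \<Rightarrow> nat" where
  "claim f xs y \<equiv> claim_code (recf_code f) (list_encode xs) y"

lemma justified_claim_code_iff: "justified D (claim_code c xs y) \<longleftrightarrow> justified_claim D c xs y"
  by (simp add: justified_def claim_code_def)

text \<open>Completeness, the counterpart of \<open>justified_sound\<close>: each rule instance
  needs only finitely many premises, so their derivations can be concatenated and the conclusion
  appended.\<close>

lemma reval_derivable: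
  assumes "reval f xs y"
  shows "derivable (claim f xs y)"
  using assms
proof (induction rule: reval.induct)
  case (reval_Z xs)
  show ?case by (rule derivable_justified[of "{}"]) (auto simp: justified_claim_code_iff justified_claim_def)
next
  case (reval_S x xs)
  show ?case
    by (rule derivable_justified[of "{}"])
      (auto simp: justified_claim_code_iff justified_claim_def)
next
  case (reval_Id i xs)
  show ?case
    by (rule derivable_justified[of "{}"])
      (use reval_Id in \<open>auto simp: justified_claim_code_iff justified_claim_def\<close>)
next
  case (reval_Cn ys gs xs f z)
  show ?case
  proof (rule derivable_justified)
    let ?A = "insert (claim f ys z) ((\<lambda>k. claim (gs ! k) xs (ys ! k)) ` {..<length gs})"
    show "finite ?A" by simp
    show "derivable w" if "w \<in> ?A" for w using that reval_Cn by auto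
    show "justified ?A (claim (Cn f gs) xs z)"
      unfolding justified_claim_code_iff justified_claim_def
      using reval_Cn.hyps(1)
      by (auto intro!: bexI[of _ "claim f ys z"])
  qed
next
  case (reval_Pr0 f xs y g)
  show ?case
    by (rule derivable_justified[of "{claim f xs y}"])
      (use reval_Pr0 in \<open>auto simp: justified_claim_code_iff justified_claim_def\<close>)
next
  case (reval_PrS f g n xs y z)
  show ?case
    by (rule derivable_justified[of "{claim (Pr f g) (n # xs) y, claim g (y # n # xs) z}"])
      (use reval_PrS in \<open>auto simp: justified_claim_code_iff justified_claim_def\<close>)
next
  case (reval_Mn f n xs)
  then obtain h where h: "\<And>m. m < n \<Longrightarrow> derivable (claim f (m # xs) (h m)) \<and> h m \<noteq> 0" by metis
  show ?case
  proof (rule derivable_justified)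
    let ?A = "insert (claim f (n # xs) 0) ((\<lambda>m. claim f (m # xs) (h m)) ` {..<n})"
    show "finite ?A" by simp
    show "derivable w" if "w \<in> ?A" for w using that reval_Mn h by auto
    show "justified ?A (claim (Mn f) xs n)"
      unfolding justified_claim_code_iff justified_claim_def
      using h by (auto)
  qed
qed

text \<open>A version of Kleene's T predicate. Here \<open>s\<close> is a certificate, coding the
  length and the entries of a derivation, and not a time bound; \<open>halts\<close> is not monotone
  in \<open>s\<close>.\<close>

definition halts :: "nat \<Rightarrow> nat \<Rightarrow> nat \<Rightarrow> bool" where
  "halts c x s \<longleftrightarrow>
     (\<forall>k<pfst s. justified (nth_code (psnd s) ` {..<k}) (nth_code (psnd s) k))
   \<and> (\<exists>k<pfst s. prog (nth_code (psnd s) k) = c \<and> args (nth_code (psnd s) k) = cons_code x 0)"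

lemma decidable_halts [comp_intros]:
  assumes "computable c" "computable x" "computable s"
  shows "decidable (\<lambda>e. halts (c e) (x e) (s e))"
  by (rule decidable_comp3[where P = halts, OF _ assms]) (unfold halts_def, intro comp_intros)

lemma halts_iff: "(\<exists>s. halts (recf_code f) x s) \<longleftrightarrow> (\<exists>y. reval f [x] y)"
proof
  assume "\<exists>s. halts (recf_code f) x s"
  then obtain s k where
    j: "\<And>k. k < pfst s \<Longrightarrow> justified (nth_code (psnd s) ` {..<k}) (nth_code (psnd s) k)" and
    k: "k < pfst s" "prog (nth_code (psnd s) k) = recf_code f" "args (nth_code (psnd s) k) = cons_code x 0"
    unfolding halts_def by blast
  have "true_claim (nth_code (psnd s) i)" if "i < pfst s" for i
    using that
  proof (induction i rule: less_induct)
    case (less i)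
    show ?case by (rule justified_sound[OF j[OF less.prems]]) (use less in auto)
  qed
  from this[OF k(1)] k(2,3) show "\<exists>y. reval f [x] y"
    using cons_code_list_encode[of x "[]"] by (auto simp: true_claim_def)
next
  assume "\<exists>y. reval f [x] y"
  then obtain y L where L: "derivation L" "claim f [x] y \<in> set L"
    using reval_derivable unfolding derivable_def by blast
  then obtain k where k: "k < length L" "L ! k = claim f [x] y" by (metis in_set_conv_nth)
  have "halts (recf_code f) x (prod_encode (length L, list_encode L))"
    unfolding halts_def pfst_encode psnd_encode
  proof (intro conjI allI impI exI[of _ k])
    fix i assume i: "i < length L"
    then have "nth_code (list_encode L) ` {..<i} = set (take i L)"
      by (force simp: image_iff in_set_conv_nth)
    with L(1) i show "justified (nth_code (list_encode L) ` {..<i}) (nth_code (list_encode L) i)"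
      by (simp add: derivation_def)
  qed (use k cons_code_list_encode[of x "[]"] in simp_all)
  then show "\<exists>s. halts (recf_code f) x s" by blast
qed

theorem ce_enumeration:
  assumes "ce A"
  obtains c where "A = {x. \<exists>s. halts c x s}"
proof -
  from assms obtain f where "A = {x. \<exists>y. reval f [x] y}" unfolding ce_def by blast
  then show thesis by (intro that[of "recf_code f"]) (simp add: halts_iff)
qed

section \<open>Effectively open sets from decidable sets of string codes\<close>

lemma str_code_lower: "2 ^ length \<sigma> \<le> str_code \<sigma>"
  and str_code_upper: "str_code \<sigma> < 2 ^ Suc (length \<sigma>)"
  by (induction \<sigma>) auto

text \<open>The head of a string is the lowest bit of its code and the leading 1 marks the end, so a
  prefix consists of the low \<open>m\<close> bits with a new leading 1. \<open>code_take\<close>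
  computes it in this way.\<close>

lemma str_code_take: "m \<le> length \<sigma> \<Longrightarrow> str_code (take m \<sigma>) = 2 ^ m + str_code \<sigma> mod 2 ^ m"
proof (induction \<sigma> arbitrary: m)
  case (Cons b \<sigma>)
  show ?case
  proof (cases m)
    case (Suc k)
    have "(2 * x + y) mod (2 * 2 ^ k) = 2 * (x mod 2 ^ k) + y" if "y < 2" for x y :: nat
      using that mod_mult2_eq[of "2 * x + y" 2 "2 ^ k"] by simp
    from this[of "if b then 1 else 0"] Cons Suc show ?thesis by auto
  qed simp
qed simp

lemma str_code_inject:
  "length \<sigma> = length \<tau> \<Longrightarrow> str_code \<sigma> = str_code \<tau> \<Longrightarrow> \<sigma> = \<tau>"
proof (induction \<sigma> \<tau> rule: list_induct2)
  case (Cons x xs y ys)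
  from Cons.prems have "x = y" by (auto split: if_splits) presburger+
  with Cons show ?case by auto
qed simp

lemma str_code_surj: "c > 0 \<Longrightarrow> \<exists>\<sigma>. str_code \<sigma> = c"
proof (induction c rule: less_induct)
  case (less c)
  show ?case
  proof (cases "c = 1")
    case True
    then show ?thesis by (intro exI[of _ "[]"]) simp
  next
    case False
    with less.prems have "c div 2 < c" "c div 2 > 0" by auto
    with less.IH obtain \<sigma> where "str_code \<sigma> = c div 2" by blast
    then have "str_code (odd c # \<sigma>) = c" by (auto elim: oddE)
    then show ?thesis by blast
  qed
qed

definition code_length :: "nat \<Rightarrow> nat" where
  "code_length c = (LEAST n. c < 2 ^ Suc n)"

definition code_take :: "nat \<Rightarrow> nat \<Rightarrow> nat" where
  "code_take m c = 2 ^ m + c mod 2 ^ m"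

lemma code_length_eq:
  assumes "2 ^ n \<le> c" "c < 2 ^ Suc n"
  shows "code_length c = n"
  unfolding code_length_def
proof (rule Least_equality)
  fix m assume "c < 2 ^ Suc m"
  with assms(1) have "(2::nat) ^ n < 2 ^ Suc m" by linarith
  then have "n < Suc m" by (rule power_less_imp_less_exp[rotated]) simp
  then show "n \<le> m" by simp
qed (fact assms(2))

lemma code_length_str_code [simp]: "code_length (str_code \<sigma>) = length \<sigma>"
  by (intro code_length_eq str_code_lower str_code_upper)

lemma computable_code_length [comp_intros]:
  assumes "computable a" shows "computable (\<lambda>e. code_length (a e))"
proof (rule computable_comp1[OF _ assms])
  have "c < 2 ^ Suc c" for c :: nat using less_exp[of "Suc c"] by linarith
  then show "computable (\<lambda>e. code_length (e 0))"
    unfolding code_length_def by (intro computable_Least comp_intros) blast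
qed

lemma computable_mod [comp_intros]:
  assumes "computable a" "computable b" shows "computable (\<lambda>e. a e mod b e :: nat)"
proof -
  have ex: "\<exists>q\<le>x. x = q * y + x mod y" for x y :: nat
    by (intro exI[of _ "x div y"]) simp
  have "(LEAST r. \<exists>q\<le>x. x = q * y + r) = x mod y" for x y :: nat
  proof (rule Least_equality)
    fix r assume "\<exists>q\<le>x. x = q * y + r"
    then show "x mod y \<le> r" by (metis mod_less_eq_dividend mod_mult_self3)
  qed (fact ex)
  moreover have "computable (\<lambda>e. LEAST r. \<exists>q\<le>a e. a e = q * b e + r)"
  proof (rule computable_Least)
    show "decidable (\<lambda>e. \<exists>q\<le>a (\<lambda>i. e (Suc i)). a (\<lambda>i. e (Suc i)) = q * b (\<lambda>i. e (Suc i)) + e 0)"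
      by (intro comp_intros computable_subst[OF assms(1)] computable_subst[OF assms(2)])
  qed (use ex in blast)
  ultimately show ?thesis by simp
qed

lemma computable_code_take [comp_intros]:
  assumes "computable a" "computable b" shows "computable (\<lambda>e. code_take (a e) (b e))"
  unfolding code_take_def by (intro comp_intros assms)

definition prefix_code :: "(nat \<Rightarrow> bool) \<Rightarrow> nat \<Rightarrow> nat" where
  "prefix_code X n = str_code (map X [0..<n])"

lemma prefix_code_bounds: "2 ^ n \<le> prefix_code X n" "prefix_code X n < 2 ^ Suc n"
  using str_code_lower[of "map X [0..<n]"] str_code_upper[of "map X [0..<n]"]
  by (simp_all add: prefix_code_def)

lemma code_length_prefix_code [simp]: "code_length (prefix_code X n) = n"
  by (simp add: prefix_code_def)

lemma code_take_prefix_code [simp]: "m \<le> n \<Longrightarrow> code_take m (prefix_code X n) = prefix_code X m"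
  using str_code_take[of m "map X [0..<n]"]
  by (simp add: prefix_code_def code_take_def take_map)

lemma cyl_iff_prefix_code: "X \<in> cyl \<sigma> \<longleftrightarrow> prefix_code X (length \<sigma>) = str_code \<sigma>"
proof -
  have "X \<in> cyl \<sigma> \<longleftrightarrow> map X [0..<length \<sigma>] = \<sigma>"
    by (simp add: cyl_def list_eq_iff_nth_eq[of _ \<sigma>])
  also have "\<dots> \<longleftrightarrow> prefix_code X (length \<sigma>) = str_code \<sigma>"
    unfolding prefix_code_def using str_code_inject[of "map X [0..<length \<sigma>]" \<sigma>] by fastforce
  finally show ?thesis .
qed

text \<open>The strings of length \<open>n\<close> fill the whole interval from \<open>2 ^ n\<close>
  to \<open>2 ^ Suc n\<close>, so quantifying over points at level \<open>n\<close> becomes a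
  bounded quantifier over numbers.\<close>

lemma ex_prefix_code:
  assumes "2 ^ n \<le> c" "c < 2 ^ Suc n"
  obtains X where "prefix_code X n = c"
proof -
  from assms(1) have "c > 0" by (metis le_zero_eq not_gr_zero power_not_zero zero_neq_numeral)
  then obtain \<sigma> where \<sigma>: "str_code \<sigma> = c" using str_code_surj by blast
  then have "length \<sigma> = n" using code_length_eq[OF assms] by auto
  moreover have "(\<lambda>i. \<sigma> ! i) \<in> cyl \<sigma>" by (simp add: cyl_def)
  ultimately show thesis using \<sigma> that cyl_iff_prefix_code by blast
qed

definition eff_open :: "(nat \<Rightarrow> bool) \<Rightarrow> (nat \<Rightarrow> bool) set" where
  "eff_open P = {X. \<exists>n. P (prefix_code X n)}"

text \<open>The length of a prefix doubles as a stage of enumeration. Persistence of acceptance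
  means that one level carries the information of all earlier ones.\<close>

definition mono_prefix :: "(nat \<Rightarrow> bool) \<Rightarrow> bool" where
  "mono_prefix P \<longleftrightarrow> (\<forall>X m n. m \<le> n \<longrightarrow> P (prefix_code X m) \<longrightarrow> P (prefix_code X n))"

lemma mono_prefixD: "mono_prefix P \<Longrightarrow> P (prefix_code X m) \<Longrightarrow> m \<le> n \<Longrightarrow> P (prefix_code X n)"
  unfolding mono_prefix_def by blast

lemma cantor_open_eff_open: "cantor_open (eff_open P)"
  unfolding cantor_open_def
proof
  fix X assume "X \<in> eff_open P"
  then obtain n where n: "P (prefix_code X n)" by (auto simp: eff_open_def)
  let ?\<sigma> = "map X [0..<n]"
  have "X \<in> cyl ?\<sigma>" by (simp add: cyl_def)
  moreover have "cyl ?\<sigma> \<subseteq> eff_open P"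
    using n by (auto simp: cyl_iff_prefix_code eff_open_def prefix_code_def[of X, symmetric] intro!: exI[of _ n])
  ultimately show "\<exists>\<sigma>. X \<in> cyl \<sigma> \<and> cyl \<sigma> \<subseteq> eff_open P" by blast
qed

text \<open>Compactness of Cantor space, in the form of Koenig's lemma: if no level works, follow the
  strings for which no level works.\<close>

lemma cyl_subset_eff_open_level:
  assumes mono: "mono_prefix P" and sub: "cyl \<sigma> \<subseteq> eff_open P"
  obtains N where "N \<ge> length \<sigma>" "\<And>X. X \<in> cyl \<sigma> \<Longrightarrow> P (prefix_code X N)"
proof -
  define covered where "covered \<rho> \<longleftrightarrow> (\<exists>N\<ge>length \<rho>. \<forall>X\<in>cyl \<rho>. P (prefix_code X N))" for \<rho>
  have step: "\<exists>b. \<not> covered (\<rho> @ [b])" if "\<not> covered \<rho>" for \<rho>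
  proof (rule ccontr)
    assume "\<nexists>b. \<not> covered (\<rho> @ [b])"
    then obtain N where N: "\<And>b. N b \<ge> Suc (length \<rho>)"
      "\<And>b X. X \<in> cyl (\<rho> @ [b]) \<Longrightarrow> P (prefix_code X (N b))"
      unfolding covered_def by simp metis
    have "P (prefix_code X (max (N True) (N False)))" if "X \<in> cyl \<rho>" for X
    proof -
      from that have "X \<in> cyl (\<rho> @ [X (length \<rho>)])"
        by (auto simp: cyl_def nth_append less_Suc_eq)
      from N(2)[OF this] show ?thesis
        by (rule mono_prefixD[OF mono]) (cases "X (length \<rho>)"; simp)
    qed
    moreover have "length \<rho> \<le> max (N True) (N False)" using N(1)[of True] by linarith
    ultimately show False using that unfolding covered_def by blast
  qed
  have "covered \<sigma>"
  proof (rule ccontr)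
    assume "\<not> covered \<sigma>"
    then obtain f where f0: "f 0 = \<sigma>" and bad: "\<And>n. \<not> covered (f n)"
      and fS: "\<And>n. \<exists>b. f (Suc n) = f n @ [b]"
      using dependent_nat_choice[of "\<lambda>n \<rho>. \<not> covered \<rho> \<and> (n = 0 \<longrightarrow> \<rho> = \<sigma>)" "\<lambda>n \<rho> \<rho>'. \<exists>b. \<rho>' = \<rho> @ [b]"]
        step by (metis Suc_neq_Zero)
    have len: "length (f n) = length \<sigma> + n" for n
    proof (induction n)
      case (Suc n)
      then show ?case using fS[of n] by auto
    qed (simp add: f0)
    have ext: "i < length (f n) \<Longrightarrow> f (n + k) ! i = f n ! i" for i n k
    proof (induction k)
      case (Suc k)
      obtain b where "f (Suc (n + k)) = f (n + k) @ [b]" using fS by blast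
      with Suc show ?case by (simp add: nth_append len)
    qed simp
    define X where "X i = f (Suc i) ! i" for i
    have X: "X \<in> cyl (f n)" for n
      unfolding cyl_def
    proof (intro CollectI allI impI)
      fix i assume "i < length (f n)"
      then show "X i = f n ! i"
        using ext[of i n "Suc i"] ext[of i "Suc i" n] by (simp add: X_def len add.commute)
    qed
    \<comment> \<open>The string \<open>f n\<close> has length at least \<open>n\<close>, so all its
      extensions share with \<open>X\<close> a prefix that is accepted, and \<open>f n\<close> is
      covered at its own length.\<close>
    from X[of 0] sub f0 obtain n where "P (prefix_code X n)" by (auto simp: eff_open_def)
    moreover have "prefix_code Y (length (f n)) = prefix_code X (length (f n))" if "Y \<in> cyl (f n)" for Y
      using that X[of n] by (simp add: cyl_iff_prefix_code)
    ultimately have "covered (f n)"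
      unfolding covered_def using mono_prefixD[OF mono, of X n "length (f n)"]
      by (intro exI[of _ "length (f n)"]) (simp add: len)
    with bad show False by blast
  qed
  then show thesis using that unfolding covered_def by blast
qed

text \<open>By compactness a cylinder lies in \<open>eff_open (P i)\<close> iff a single level
  accepts all extensions of its string. For each level this is a bounded check, so the inclusions
  form a projection of a decidable relation.\<close>

lemma unif_eff_open_eff_open:
  assumes dec: "decidable (\<lambda>e. P (e 0) (e (Suc 0)))" and mono: "\<And>i. mono_prefix (P i)"
  shows "unif_eff_open (\<lambda>i. eff_open (P i))"
proof -
  \<comment> \<open>\<open>N\<close> is the level provided by compactness. The condition
    \<open>psnd z > 0\<close> excludes 0, the only number that codes no string.\<close>
  define Q where "Q z N \<longleftrightarrow> psnd z > 0 \<and> code_length (psnd z) \<le> N \<and>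
    (\<forall>d<2 ^ Suc N. 2 ^ N \<le> d \<longrightarrow> code_take (code_length (psnd z)) d = psnd z \<longrightarrow> P (pfst z) d)" for z N
  have Q: "(\<exists>N. Q (pair_code i \<sigma>) N) \<longleftrightarrow> cyl \<sigma> \<subseteq> eff_open (P i)" for i \<sigma>
  proof -
    have pos: "str_code \<sigma> > 0" using str_code_lower[of \<sigma>] by (metis le_zero_eq not_gr_zero power_not_zero zero_neq_numeral)
    have iff: "Q (pair_code i \<sigma>) N \<longleftrightarrow> length \<sigma> \<le> N \<and> (\<forall>X\<in>cyl \<sigma>. P i (prefix_code X N))" for N
    proof -
      have "(\<forall>d<2 ^ Suc N. 2 ^ N \<le> d \<longrightarrow> R d) \<longleftrightarrow> (\<forall>X. R (prefix_code X N))" for R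
        using prefix_code_bounds ex_prefix_code by metis
      then show ?thesis
        using pos by (auto simp: Q_def pair_code_def cyl_iff_prefix_code)
    qed
    show ?thesis
    proof
      assume "\<exists>N. Q (pair_code i \<sigma>) N"
      then show "cyl \<sigma> \<subseteq> eff_open (P i)" unfolding iff eff_open_def by blast
    next
      assume "cyl \<sigma> \<subseteq> eff_open (P i)"
      then show "\<exists>N. Q (pair_code i \<sigma>) N"
        unfolding iff using cyl_subset_eff_open_level[OF mono] by metis
    qed
  qed
  have "{pair_code i \<sigma> |i \<sigma>. cyl \<sigma> \<subseteq> eff_open (P i)} = {z. \<exists>N. Q z N}"
  proof (intro equalityI subsetI)
    fix z assume "z \<in> {z. \<exists>N. Q z N}"
    then obtain N where N: "Q z N" by blast
    then obtain \<sigma> where "str_code \<sigma> = psnd z" using str_code_surj unfolding Q_def by blast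
    then have "z = pair_code (pfst z) \<sigma>" by (simp add: pair_code_def)
    with N Q show "z \<in> {pair_code i \<sigma> |i \<sigma>. cyl \<sigma> \<subseteq> eff_open (P i)}" by (metis (mono_tags, lifting) mem_Collect_eq)
  qed (use Q in auto)
  moreover have "ce {z. \<exists>N. Q z N}"
    unfolding Q_def by (rule ce_projection) (intro comp_intros decidable_comp2[OF dec])
  ultimately show ?thesis
    by (simp add: unif_eff_open_def cantor_open_eff_open)
qed

section \<open>Measure of effectively open sets\<close>

lemma product_prob_space_coin:
  "product_prob_space (\<lambda>n::nat. measure_pmf (pmf_of_set (UNIV :: bool set)))"
  by unfold_locales (simp_all add: measure_pmf.emeasure_space_1)

lemma cyl_eq_prod_emb:
  "cyl \<sigma> = prod_emb UNIV (\<lambda>n. measure_pmf (pmf_of_set (UNIV :: bool set))) {..<length \<sigma>}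
             (Pi\<^sub>E {..<length \<sigma>} (\<lambda>n. {\<sigma> ! n}))"
  by (auto simp: cyl_def prod_emb_def PiE_iff extensional_def restrict_def)

lemma pair_code_inject: "pair_code i \<sigma> = pair_code j \<tau> \<longleftrightarrow> i = j \<and> \<sigma> = \<tau>"
  using str_code_inject[of \<sigma> \<tau>] code_length_str_code[of \<sigma>] code_length_str_code[of \<tau>]
  by (auto simp: pair_code_def simp del: code_length_str_code)

lemma cyl_in_sets: "cyl \<sigma> \<in> sets lebesgue_cantor"
  unfolding lebesgue_cantor_def cyl_eq_prod_emb by (intro sets_PiM_I) auto

lemma cantor_open_in_sets:
  assumes "cantor_open U"
  shows "U \<in> sets lebesgue_cantor"
proof -
  have "U = (\<Union>\<sigma>\<in>{\<sigma>. cyl \<sigma> \<subseteq> U}. cyl \<sigma>)"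
    using assms unfolding cantor_open_def by blast
  also have "\<dots> \<in> sets lebesgue_cantor"
    by (intro sets.countable_UN') (auto simp: cyl_in_sets)
  finally show ?thesis .
qed

lemma space_lebesgue_cantor: "space lebesgue_cantor = UNIV"
  by (simp add: lebesgue_cantor_def space_PiM)

lemma emeasure_cyl: "emeasure lebesgue_cantor (cyl \<sigma>) = ennreal ((1/2) ^ length \<sigma>)"
proof -
  interpret product_prob_space "\<lambda>n::nat. measure_pmf (pmf_of_set (UNIV :: bool set))" UNIV
    by (rule product_prob_space_coin)
  have "emeasure lebesgue_cantor (cyl \<sigma>) =
      (\<Prod>n<length \<sigma>. emeasure (measure_pmf (pmf_of_set (UNIV :: bool set))) {\<sigma> ! n})"
    unfolding lebesgue_cantor_def cyl_eq_prod_emb by (rule emeasure_PiM_emb) auto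
  also have "\<dots> = (\<Prod>n<length \<sigma>. ennreal (1/2))"
    by (simp add: emeasure_pmf_single pmf_of_set)
  also have "\<dots> = ennreal ((1/2) ^ length \<sigma>)"
    by (subst prod_constant, subst ennreal_power) simp_all
  finally show ?thesis .
qed

definition level_codes :: "nat \<Rightarrow> (nat \<Rightarrow> bool) \<Rightarrow> nat set" where
  "level_codes n P = {d. 2 ^ n \<le> d \<and> d < 2 ^ Suc n \<and> P d}"

lemma finite_level_codes: "finite (level_codes n P)"
  by (rule finite_subset[of _ "{..<2 ^ Suc n}"]) (auto simp: level_codes_def)

lemma prefix_code_fibre:
  assumes "d \<in> level_codes n P"
  shows "{X. prefix_code X n = d} \<in> sets lebesgue_cantor"
    and "emeasure lebesgue_cantor {X. prefix_code X n = d} = ennreal ((1/2) ^ n)"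
proof -
  obtain Y where "prefix_code Y n = d"
    using assms ex_prefix_code unfolding level_codes_def by blast
  then have "{X. prefix_code X n = d} = cyl (map Y [0..<n])"
    by (auto simp: cyl_iff_prefix_code prefix_code_def[of Y])
  then show "{X. prefix_code X n = d} \<in> sets lebesgue_cantor"
    and "emeasure lebesgue_cantor {X. prefix_code X n = d} = ennreal ((1/2) ^ n)"
    by (simp_all add: cyl_in_sets emeasure_cyl)
qed

lemma level_eq_UN: "{X. P (prefix_code X n)} = (\<Union>d\<in>level_codes n P. {X. prefix_code X n = d})"
  using prefix_code_bounds by (auto simp: level_codes_def)

lemma level_in_sets: "{X. P (prefix_code X n)} \<in> sets lebesgue_cantor"
  unfolding level_eq_UN by (intro sets.finite_UN finite_level_codes prefix_code_fibre)

lemma emeasure_level: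
  "emeasure lebesgue_cantor {X. P (prefix_code X n)} = ennreal (card (level_codes n P) * (1/2) ^ n)"
proof -
  have "emeasure lebesgue_cantor {X. P (prefix_code X n)} =
      (\<Sum>d\<in>level_codes n P. emeasure lebesgue_cantor {X. prefix_code X n = d})"
    unfolding level_eq_UN
    by (intro sum_emeasure[symmetric] finite_level_codes)
      (auto simp: disjoint_family_on_def intro: prefix_code_fibre)
  also have "\<dots> = (\<Sum>d\<in>level_codes n P. ennreal ((1/2) ^ n))"
    by (intro sum.cong prefix_code_fibre) auto
  also have "\<dots> = ennreal (card (level_codes n P) * (1/2) ^ n)"
    by (simp add: ennreal_mult ennreal_of_nat_eq_real_of_nat)
  finally show ?thesis .
qed

lemma eff_open_in_sets: "eff_open P \<in> sets lebesgue_cantor"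
  by (rule cantor_open_in_sets[OF cantor_open_eff_open])

text \<open>Turns the measure bound into a comparison of integers; this is why
  \<open>small_level\<close> is decidable.\<close>

lemma emeasure_level_le_iff:
  "emeasure lebesgue_cantor {X. P (prefix_code X n)} \<le> ennreal ((1/2) ^ i)
     \<longleftrightarrow> 2 ^ i * card (level_codes n P) \<le> 2 ^ n"
proof -
  have "emeasure lebesgue_cantor {X. P (prefix_code X n)} \<le> ennreal ((1/2) ^ i)
      \<longleftrightarrow> real (card (level_codes n P)) * (1/2) ^ n \<le> (1/2) ^ i"
    unfolding emeasure_level by (rule ennreal_le_iff) simp
  also have "\<dots> \<longleftrightarrow> real (2 ^ i * card (level_codes n P)) \<le> real (2 ^ n)"
    by (simp add: field_simps)
  also have "\<dots> \<longleftrightarrow> 2 ^ i * card (level_codes n P) \<le> 2 ^ n"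
    by (rule of_nat_le_iff)
  finally show ?thesis .
qed

section \<open>A universal test\<close>

text \<open>Bounding both the prefix and the certificate by the length of the string restores the
  monotonicity that \<open>halts\<close> lacks.\<close>

definition enum_test :: "nat \<Rightarrow> nat \<Rightarrow> nat \<Rightarrow> bool" where
  "enum_test c i d \<longleftrightarrow>
     (\<exists>m\<le>code_length d. \<exists>s\<le>code_length d. halts c (prod_encode (i, code_take m d)) s)"

definition small_level :: "nat \<Rightarrow> nat \<Rightarrow> nat \<Rightarrow> bool" where
  "small_level c i n \<longleftrightarrow> 2 ^ i * (\<Sum>d<2 ^ Suc n. of_bool (2 ^ n \<le> d \<and> enum_test c i d)) \<le> (2::nat) ^ n"

text \<open>The \<^term>\<open>c\<close>-th effectively open sequence is cut off as soon as its measure gets too large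
  and contributes its component \<^term>\<open>i + c + 1\<close> to component \<^term>\<open>i\<close> of the universal test.\<close>

definition univ_test :: "nat \<Rightarrow> nat \<Rightarrow> bool" where
  "univ_test i d \<longleftrightarrow> (\<exists>c\<le>code_length d. \<exists>m\<le>code_length d.
     small_level c (i + c + 1) m \<and> enum_test c (i + c + 1) (code_take m d))"

lemma decidable_enum_test [comp_intros]:
  assumes "computable c" "computable i" "computable d"
  shows "decidable (\<lambda>e. enum_test (c e) (i e) (d e))"
  by (rule decidable_comp3[where P = enum_test, OF _ assms]) (unfold enum_test_def, intro comp_intros)

lemma decidable_small_level [comp_intros]:
  assumes "computable c" "computable i" "computable n"
  shows "decidable (\<lambda>e. small_level (c e) (i e) (n e))"
  by (rule decidable_comp3[where P = small_level, OF _ assms])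
    (unfold small_level_def, intro comp_intros)

lemma decidable_univ_test [comp_intros]:
  assumes "computable i" "computable d"
  shows "decidable (\<lambda>e. univ_test (i e) (d e))"
  by (rule decidable_comp2[where P = univ_test, OF _ assms]) (unfold univ_test_def, intro comp_intros)

lemma mono_prefix_enum_test: "mono_prefix (enum_test c i)"
  unfolding mono_prefix_def
proof (intro allI impI)
  fix X m n assume "m \<le> n" "enum_test c i (prefix_code X m)"
  then obtain k s where "k \<le> m" "s \<le> m" "halts c (prod_encode (i, prefix_code X k)) s"
    by (auto simp: enum_test_def)
  with \<open>m \<le> n\<close> show "enum_test c i (prefix_code X n)"
    unfolding enum_test_def by (intro exI[of _ k] conjI exI[of _ s]) simp_all
qed

lemma mono_prefix_univ_test: "mono_prefix (univ_test i)"
  unfolding mono_prefix_def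
proof (intro allI impI)
  fix X m n assume "m \<le> n" "univ_test i (prefix_code X m)"
  then obtain c k where "c \<le> m" "k \<le> m" "small_level c (i + c + 1) k" "enum_test c (i + c + 1) (prefix_code X k)"
    by (auto simp: univ_test_def)
  with \<open>m \<le> n\<close> show "univ_test i (prefix_code X n)"
    unfolding univ_test_def by (intro exI[of _ c] conjI exI[of _ k]) simp_all
qed

lemma small_level_iff:
  "small_level c i n \<longleftrightarrow>
     emeasure lebesgue_cantor {X. enum_test c i (prefix_code X n)} \<le> ennreal ((1/2) ^ i)"
proof -
  have "level_codes n (enum_test c i) = {..<2 ^ Suc n} \<inter> {d. 2 ^ n \<le> d \<and> enum_test c i d}"
    by (auto simp: level_codes_def)
  then show ?thesis
    unfolding emeasure_level_le_iff small_level_def by (simp add: sum_of_bool_eq)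
qed

definition cut_off :: "nat \<Rightarrow> nat \<Rightarrow> (nat \<Rightarrow> bool) set" where
  "cut_off c i = (\<Union>n\<in>{n. small_level c i n}. {X. enum_test c i (prefix_code X n)})"

lemma eff_open_univ_test: "eff_open (univ_test i) = (\<Union>c. cut_off c (i + c + 1))"
proof (intro equalityI subsetI)
  fix X assume "X \<in> (\<Union>c. cut_off c (i + c + 1))"
  then obtain c m where "small_level c (i + c + 1) m" "enum_test c (i + c + 1) (prefix_code X m)"
    by (auto simp: cut_off_def)
  \<comment> \<open>\<open>univ_test\<close> requires both the index and the level to be at most the
    length of the string.\<close>
  then have "univ_test i (prefix_code X (max c m))"
    unfolding univ_test_def by (intro exI[of _ c] conjI exI[of _ m]) simp_all
  then show "X \<in> eff_open (univ_test i)" by (auto simp: eff_open_def)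
next
  fix X assume "X \<in> eff_open (univ_test i)"
  then obtain c m where "small_level c (i + c + 1) m" "enum_test c (i + c + 1) (prefix_code X m)"
    by (auto simp: eff_open_def univ_test_def)
  then show "X \<in> (\<Union>c. cut_off c (i + c + 1))" unfolding cut_off_def by blast
qed

lemma cut_off_in_sets: "cut_off c i \<in> sets lebesgue_cantor"
  unfolding cut_off_def by (intro sets.countable_UN') (auto simp: level_in_sets)

text \<open>The levels increase with \<open>n\<close>, so the small levels up to \<open>N\<close>
  all lie in the last of them, which obeys the bound; continuity from below handles the union over
  \<open>N\<close>.\<close>

lemma emeasure_cut_off: "emeasure lebesgue_cantor (cut_off c i) \<le> ennreal ((1/2) ^ i)"
proof -
  define L where "L n = {X. enum_test c i (prefix_code X n)}" for n
  define B where "B N = (\<Union>n\<in>{n. n \<le> N \<and> small_level c i n}. L n)" for N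
  have L: "m \<le> n \<Longrightarrow> L m \<subseteq> L n" for m n
    using mono_prefix_enum_test unfolding L_def by (auto dest: mono_prefixD)
  have "emeasure lebesgue_cantor (B N) \<le> ennreal ((1/2) ^ i)" for N
  proof (cases "{n. n \<le> N \<and> small_level c i n} = {}")
    case False
    define n where "n = Max {n. n \<le> N \<and> small_level c i n}"
    have n: "n \<in> {n. n \<le> N \<and> small_level c i n}"
      unfolding n_def using False by (intro Max_in) auto
    have "m \<le> n" if "m \<le> N" "small_level c i m" for m
      unfolding n_def using that by (intro Max_ge) auto
    with L have "B N \<subseteq> L n" unfolding B_def by blast
    then have "emeasure lebesgue_cantor (B N) \<le> emeasure lebesgue_cantor (L n)"
      by (intro emeasure_mono) (simp_all add: L_def level_in_sets)
    also have "\<dots> \<le> ennreal ((1/2) ^ i)" using n by (simp add: small_level_iff L_def)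
    finally show ?thesis .
  next
    case True
    then have "B N = {}" unfolding B_def by blast
    then show ?thesis by simp
  qed
  moreover have "emeasure lebesgue_cantor (\<Union>N. B N) = (SUP N. emeasure lebesgue_cantor (B N))"
  proof (intro SUP_emeasure_incseq[symmetric])
    show "range B \<subseteq> sets lebesgue_cantor"
      by (auto simp: B_def L_def intro!: sets.finite_UN level_in_sets)
    show "incseq B" unfolding incseq_def B_def by (blast intro: order_trans)
  qed
  moreover have "cut_off c i = (\<Union>N. B N)" by (auto simp: cut_off_def B_def L_def)
  ultimately show ?thesis by (auto intro: SUP_least)
qed

text \<open>The shift by \<open>c + 1\<close> makes the contributions sum to 2^(-i).\<close>

lemma emeasure_univ_test: "emeasure lebesgue_cantor (eff_open (univ_test i)) \<le> ennreal ((1/2) ^ i)"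
proof -
  have "emeasure lebesgue_cantor (eff_open (univ_test i))
      \<le> (\<Sum>c. emeasure lebesgue_cantor (cut_off c (i + c + 1)))"
    unfolding eff_open_univ_test
    by (intro emeasure_subadditive_countably) (auto intro: cut_off_in_sets)
  also have "\<dots> \<le> (\<Sum>c. ennreal ((1/2) ^ i * (1/2) ^ Suc c))"
  proof (intro suminf_le)
    show "emeasure lebesgue_cantor (cut_off c (i + c + 1)) \<le> ennreal ((1/2) ^ i * (1/2) ^ Suc c)" for c
      using emeasure_cut_off[of c "i + c + 1"] by (simp add: power_add)
  qed auto
  also have "(\<lambda>c. (1/2) ^ i * (1/2) ^ Suc c) sums ((1/2::real) ^ i * 1)"
    by (intro sums_mult power_half_series)
  then have "(\<Sum>c. ennreal ((1/2) ^ i * (1/2) ^ Suc c)) = ennreal ((1/2) ^ i)"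
    by (subst suminf_ennreal2) (auto simp: sums_iff)
  finally show ?thesis .
qed

text \<open>If \<open>c\<close> enumerates a genuine test, every level of component \<open>j\<close>
  stays inside \<open>V j\<close> and is small, so nothing is cut off. The argument uses only
  membership in the single component \<open>V j\<close>.\<close>

lemma univ_test_covers:
  assumes V: "MartinLoef_test V"
  shows "(\<Inter>i. V i) \<subseteq> eff_open (univ_test i)"
proof
  have "ce {pair_code i \<sigma> | i \<sigma>. cyl \<sigma> \<subseteq> V i}"
    using V unfolding MartinLoef_test_def unif_eff_open_def by blast
  then obtain c where c: "{pair_code i \<sigma> | i \<sigma>. cyl \<sigma> \<subseteq> V i} = {x. \<exists>s. halts c x s}"
    by (rule ce_enumeration)
  define j where "j = i + c + 1"
  have V_iff: "cyl \<sigma> \<subseteq> V j \<longleftrightarrow> (\<exists>s. halts c (prod_encode (j, str_code \<sigma>)) s)" for \<sigma>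
  proof -
    have "cyl \<sigma> \<subseteq> V j \<longleftrightarrow> pair_code j \<sigma> \<in> {pair_code i \<sigma> | i \<sigma>. cyl \<sigma> \<subseteq> V i}"
      by (auto simp: pair_code_inject)
    then show ?thesis unfolding c by (simp add: pair_code_def)
  qed
  fix X assume "X \<in> (\<Inter>i. V i)"
  then have "X \<in> V j" by blast
  then obtain \<sigma> where \<sigma>: "X \<in> cyl \<sigma>" "cyl \<sigma> \<subseteq> V j"
    using V unfolding MartinLoef_test_def unif_eff_open_def cantor_open_def by blast
  then obtain s where s: "halts c (prod_encode (j, str_code \<sigma>)) s" using V_iff by blast
  have "enum_test c j (prefix_code X (max (length \<sigma>) s))"
    unfolding enum_test_def
    using s \<sigma>(1) by (intro exI[of _ "length \<sigma>"] conjI exI[of _ s]) (simp_all add: cyl_iff_prefix_code)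
  moreover have "small_level c j n" for n
  proof -
    have "{X. enum_test c j (prefix_code X n)} \<subseteq> V j"
    proof
      fix Y assume "Y \<in> {X. enum_test c j (prefix_code X n)}"
      then obtain m s where "halts c (prod_encode (j, str_code (map Y [0..<m]))) s"
        by (auto simp: enum_test_def prefix_code_def[of _ "_ :: nat", symmetric])
      then have "cyl (map Y [0..<m]) \<subseteq> V j" using V_iff by blast
      then show "Y \<in> V j" by (auto simp: cyl_def)
    qed
    moreover have "V j \<in> sets lebesgue_cantor"
      using V unfolding MartinLoef_test_def unif_eff_open_def by (blast intro: cantor_open_in_sets)
    ultimately show ?thesis
      using V unfolding small_level_iff MartinLoef_test_def by (blast intro: order_trans emeasure_mono)
  qed
  ultimately show "X \<in> eff_open (univ_test i)"
    unfolding eff_open_univ_test cut_off_def j_def by auto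
qed

section \<open>A test not dominated by a universal test\<close>

text \<open>Otherwise component 1 would be the whole space, of measure 1 instead of at most 1/2.
  Component 0, with bound 1, would give no contradiction.\<close>

lemma ex_avoiding_code: "\<exists>d. 2 ^ t \<le> d \<and> d < 2 ^ Suc t \<and> \<not> univ_test 1 d"
proof (rule ccontr)
  assume "\<not> ?thesis"
  then have "eff_open (univ_test 1) = space lebesgue_cantor"
    using prefix_code_bounds unfolding eff_open_def space_lebesgue_cantor by blast
  moreover have "emeasure lebesgue_cantor (space lebesgue_cantor) = 1"
    using emeasure_cyl[of "[]"] by (simp add: cyl_def space_lebesgue_cantor)
  ultimately have "ennreal 1 \<le> ennreal ((1/2) ^ 1)"
    using emeasure_univ_test[of 1] by (metis ennreal_1)
  then show False by (subst (asm) ennreal_le_iff) auto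
qed

definition avoiding_code :: "nat \<Rightarrow> nat" where
  "avoiding_code t = (LEAST d. 2 ^ t \<le> d \<and> d < 2 ^ Suc t \<and> \<not> univ_test 1 d)"

lemma avoiding_code:
  "2 ^ t \<le> avoiding_code t" "avoiding_code t < 2 ^ Suc t" "\<not> univ_test 1 (avoiding_code t)"
  using LeastI_ex[OF ex_avoiding_code[of t]] unfolding avoiding_code_def by blast+

lemma computable_avoiding_code [comp_intros]:
  assumes "computable a" shows "computable (\<lambda>e. avoiding_code (a e))"
proof (rule computable_comp1[OF _ assms])
  show "computable (\<lambda>e. avoiding_code (e 0))"
    unfolding avoiding_code_def
    by (rule computable_Least, intro comp_intros) (rule ex_avoiding_code)
qed

definition avoiding_test :: "nat \<Rightarrow> nat \<Rightarrow> bool" where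
  "avoiding_test j d \<longleftrightarrow> j \<le> code_length d \<and> code_take j d = avoiding_code j"

text \<open>Inside the cylinder of \<^term>\<open>avoiding_code t\<close> only points of component \<^term>\<open>t + 1\<close> of the
  universal test are kept, so the cylinder is not covered. Membership remains semidecidable because
  a string that is put into component 1 at length \<^term>\<open>s\<close> is not avoided at lengths
  \<^term>\<open>t \<ge> s\<close>.\<close>

definition thin_test :: "nat \<Rightarrow> nat \<Rightarrow> bool" where
  "thin_test i d \<longleftrightarrow> (\<exists>s\<le>code_length d. univ_test (i + 1) (code_take s d) \<and>
     (\<forall>t<s. code_take t d = avoiding_code t \<longrightarrow> univ_test (t + 1) d))"

lemma mono_prefix_avoiding_test: "mono_prefix (avoiding_test j)"
  by (auto simp: mono_prefix_def avoiding_test_def)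

lemma mono_prefix_thin_test: "mono_prefix (thin_test i)"
  unfolding mono_prefix_def
proof (intro allI impI)
  fix X m n assume mn: "m \<le> n" and "thin_test i (prefix_code X m)"
  then obtain s where s: "s \<le> m" "univ_test (i + 1) (prefix_code X s)"
    "\<And>t. t < s \<Longrightarrow> prefix_code X t = avoiding_code t \<Longrightarrow> univ_test (t + 1) (prefix_code X m)"
    by (auto simp: thin_test_def)
  with mn show "thin_test i (prefix_code X n)"
    unfolding thin_test_def
    by (intro exI[of _ s]) (auto intro: mono_prefixD[OF mono_prefix_univ_test])
qed

lemma eff_open_avoiding_test: "eff_open (avoiding_test j) = {X. prefix_code X j = avoiding_code j}"
proof -
  have "avoiding_test j (prefix_code X n) \<longleftrightarrow> j \<le> n \<and> prefix_code X j = avoiding_code j" for X n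
    by (auto simp: avoiding_test_def)
  then show ?thesis by (auto simp: eff_open_def)
qed

lemma emeasure_avoiding_test:
  "emeasure lebesgue_cantor (eff_open (avoiding_test j)) = ennreal ((1/2) ^ j)"
  unfolding eff_open_avoiding_test
  by (rule prefix_code_fibre[where P = "\<lambda>_. True"]) (use avoiding_code in \<open>simp add: level_codes_def\<close>)

lemma MartinLoef_avoiding_test: "MartinLoef_test (\<lambda>j. eff_open (avoiding_test j))"
  unfolding MartinLoef_test_def
proof (intro conjI allI unif_eff_open_eff_open mono_prefix_avoiding_test)
  show "decidable (\<lambda>e. avoiding_test (e 0) (e (Suc 0)))"
    unfolding avoiding_test_def by (intro comp_intros)
qed (simp add: emeasure_avoiding_test)

lemma thin_test_subset: "eff_open (thin_test i) \<subseteq> eff_open (univ_test (i + 1))"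
  by (auto simp: eff_open_def thin_test_def)

lemma MartinLoef_thin_test: "MartinLoef_test (\<lambda>i. eff_open (thin_test i))"
  unfolding MartinLoef_test_def
proof (intro conjI allI unif_eff_open_eff_open mono_prefix_thin_test)
  show "decidable (\<lambda>e. thin_test (e 0) (e (Suc 0)))"
    unfolding thin_test_def by (intro comp_intros)
  fix i
  have "emeasure lebesgue_cantor (eff_open (thin_test i))
      \<le> emeasure lebesgue_cantor (eff_open (univ_test (i + 1)))"
    by (intro emeasure_mono thin_test_subset eff_open_in_sets)
  also have "\<dots> \<le> ennreal ((1/2) ^ (i + 1))" by (rule emeasure_univ_test)
  also have "\<dots> \<le> ennreal ((1/2) ^ i)" by (intro ennreal_leI power_decreasing) auto
  finally show "emeasure lebesgue_cantor (eff_open (thin_test i)) \<le> ennreal ((1/2) ^ i)" .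
qed

lemma eff_open_univ_test_thin_test: "(\<Inter>i. eff_open (univ_test i)) \<subseteq> eff_open (thin_test i)"
proof
  fix X assume "X \<in> (\<Inter>i. eff_open (univ_test i))"
  then obtain n where n: "\<And>i. univ_test i (prefix_code X (n i))"
    by (auto simp: eff_open_def) metis
  \<comment> \<open>A length past acceptance into component \<open>i + 1\<close> and, for each of
    the finitely many \<open>t\<close> below that acceptance length, past acceptance into component
    \<open>t + 1\<close>.\<close>
  define N where "N = Max (insert (n (i + 1)) ((\<lambda>t. n (t + 1)) ` {..<n (i + 1)}))"
  have N: "n (i + 1) \<le> N" "\<And>t. t < n (i + 1) \<Longrightarrow> n (t + 1) \<le> N"
    unfolding N_def by (auto intro: Max_ge)
  have "thin_test i (prefix_code X N)"
    unfolding thin_test_def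
    using N n by (intro exI[of _ "n (i + 1)"] conjI allI impI)
      (auto intro: mono_prefixD[OF mono_prefix_univ_test])
  then show "X \<in> eff_open (thin_test i)" by (auto simp: eff_open_def)
qed

lemma thin_test_inter_avoiding_test:
  "eff_open (thin_test 0) \<inter> eff_open (avoiding_test t) \<subseteq> eff_open (univ_test (t + 1))"
proof
  fix X assume "X \<in> eff_open (thin_test 0) \<inter> eff_open (avoiding_test t)"
  then have X: "prefix_code X t = avoiding_code t" and "X \<in> eff_open (thin_test 0)"
    by (auto simp: eff_open_avoiding_test)
  then obtain n s where s: "univ_test 1 (prefix_code X s)"
    and thin: "\<forall>t<s. prefix_code X t = avoiding_code t \<longrightarrow> univ_test (t + 1) (prefix_code X n)"
    by (auto simp: eff_open_def thin_test_def)
  \<comment> \<open>If \<open>s\<close> were at most \<open>t\<close>, acceptance at length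
    \<open>s\<close> would persist to length \<open>t\<close>, where the prefix of \<open>X\<close>
    is \<open>avoiding_code t\<close>. Hence the thinning condition for \<open>t\<close> applies to
    \<open>X\<close>.\<close>
  have "t < s"
    using mono_prefixD[OF mono_prefix_univ_test s, of t] X avoiding_code(3)[of t] by (metis not_less)
  then show "X \<in> eff_open (univ_test (t + 1))" using thin X by (auto simp: eff_open_def)
qed

lemma avoiding_test_not_subset: "\<not> eff_open (avoiding_test t) \<subseteq> eff_open (thin_test 0)"
proof
  assume "eff_open (avoiding_test t) \<subseteq> eff_open (thin_test 0)"
  then have "eff_open (avoiding_test t) \<subseteq> eff_open (univ_test (t + 1))"
    using thin_test_inter_avoiding_test by blast
  then have "ennreal ((1/2) ^ t) \<le> emeasure lebesgue_cantor (eff_open (univ_test (t + 1)))"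
    unfolding emeasure_avoiding_test[symmetric] by (intro emeasure_mono eff_open_in_sets)
  also have "\<dots> \<le> ennreal ((1/2) ^ (t + 1))" by (rule emeasure_univ_test)
  finally have "(1/2::real) ^ t \<le> (1/2) ^ (t + 1)" by (subst (asm) ennreal_le_iff) auto
  then show False by simp
qed

theorem theorem3p2:
  shows "\<exists>U V. MartinLoef_test U \<and> MartinLoef_test V \<and> universal_MartinLoef_test U
           \<and> (\<exists>i. \<forall>j. \<not> (V j \<subseteq> U i))"
proof (rule exI[of _ "\<lambda>i. eff_open (thin_test i)"], rule exI[of _ "\<lambda>j. eff_open (avoiding_test j)"],
    intro conjI exI[of _ 0] allI)
  have "(\<Inter>i. V i) \<subseteq> (\<Inter>i. eff_open (thin_test i))" if "MartinLoef_test V" for V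
  proof -
    have "(\<Inter>i. V i) \<subseteq> (\<Inter>i. eff_open (univ_test i))"
      using univ_test_covers[OF that] by (rule INT_greatest)
    then show ?thesis
      using eff_open_univ_test_thin_test by (intro INT_greatest) (rule order_trans)
  qed
  then show "universal_MartinLoef_test (\<lambda>i. eff_open (thin_test i))"
    by (simp add: universal_MartinLoef_test_def MartinLoef_thin_test)
qed (rule MartinLoef_thin_test MartinLoef_avoiding_test avoiding_test_not_subset)+

end
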